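(* Let $E$ and $F$ be Banach spaces. (a) If the pair $(E, F)$ has the quasi-WMP, then it also has the bidual-WMP. (b) If $F$ is reflexive, then $(E, F)$ has the quasi-WMP if and only if it has the bidual-WMP. (c) If $E$ is reflexive, then the following are equivalent: $(E, F)$ has the WMP; $(E,F)$ has the quasi-WMP; $(E,F)$ has the bidual-WMP.
   Context: Banach spaces are over $\mathbb{K} = \mathbb{R}$ or $\mathbb{C}$; $S_E$ is the unit sphere of $E$. A bounded linear operator $T:E\to F$ attains its norm if there is $x_0\in S_E$ with $\|T(x_0)\|=\|T\|$. $T$ quasi attains its norm if there is a sequence $(x_n)\subset S_E$ such that $T(x_n)\to u$ in norm for some $u\in F$ with $\|u\|=\|T\|$. A maximizing sequence for $T$ is a sequence $(x_n)\subset S_E$ with $\|T(x_n)\|\to\|T\|$; it is non-weakly null if it does not converge weakly to $0$. The pair $(E,F)$ has the WMP (respectively, the quasi-WMP; the bidual-WMP) if for every bounded linear operator $T:E\to F$, the existence of a non-weakly null maximizing sequence for $T$ implies that $T$ attains its norm (respectively, that $T$ quasi attains its norm; that the second adjoint $T^{**}:E^{**}\to F^{**}$ attains its norm). *)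

theory Defs
  imports "HOL-Analysis.Analysis"
begin

(* The scalar field K: a real normed field that is, as a normed field, either R or C. *)

class real_or_complex = real_normed_field +
  assumes real_or_complex:
    "\<exists>\<phi> :: 'a \<Rightarrow> complex.
       (\<forall>x y. \<phi> (x + y) = \<phi> x + \<phi> y) \<and> (\<forall>x y. \<phi> (x * y) = \<phi> x * \<phi> y) \<and>
       (\<forall>r x. \<phi> (r *\<^sub>R x) = r *\<^sub>R \<phi> x) \<and> \<phi> 1 = 1 \<and> (\<forall>x. norm (\<phi> x) = norm x) \<and>
       (range \<phi> = \<real> \<or> range \<phi> = UNIV)"

instance real :: real_or_complex
  by standard (rule exI[of _ complex_of_real], auto simp: Reals_def scaleR_conv_of_real)

instance complex :: real_or_complex
  by standard (rule exI[of _ id], auto)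


(* A Banach space over K is a type of class banach (complete, with its real structure) together
   with a scalar multiplication by K extending the real one and compatible with the norm. *)

locale banach_over = vector_space scale
  for scale :: "'k::real_or_complex \<Rightarrow> 'a::banach \<Rightarrow> 'a" +
  assumes scale_of_real: "scale (of_real r) x = r *\<^sub>R x"
    and norm_scale: "norm (scale c x) = norm c * norm x"

lemma banach_over_real: "banach_over (scaleR :: real \<Rightarrow> 'a::banach \<Rightarrow> 'a)"
  by unfold_locales (auto simp: algebra_simps)

lemma banach_over_complex: "banach_over ((*) :: complex \<Rightarrow> complex \<Rightarrow> complex)"
  by unfold_locales (auto simp: algebra_simps norm_mult scaleR_conv_of_real)


(* Bounded K-linear operators. The type of bounded linear maps of the library only records
   real linearity; its norm is the operator norm. *)

definition operators ::
    "('k::field \<Rightarrow> 'a::real_normed_vector \<Rightarrow> 'a) \<Rightarrow> ('k \<Rightarrow> 'b::real_normed_vector \<Rightarrow> 'b)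
      \<Rightarrow> ('a \<Rightarrow>\<^sub>L 'b) set" where
  "operators sE sF = {T. Vector_Spaces.linear sE sF (blinfun_apply T)}"

definition attains_norm :: "('a::real_normed_vector \<Rightarrow>\<^sub>L 'b::real_normed_vector) \<Rightarrow> bool" where
  "attains_norm T \<longleftrightarrow> (\<exists>x. norm x = 1 \<and> norm (T x) = norm T)"

definition quasi_attains_norm ::
    "('a::real_normed_vector \<Rightarrow>\<^sub>L 'b::real_normed_vector) \<Rightarrow> bool" where
  "quasi_attains_norm T \<longleftrightarrow>
     (\<exists>(x :: nat \<Rightarrow> 'a) u. (\<forall>n. norm (x n) = 1) \<and> (\<lambda>n. T (x n)) \<longlonglongrightarrow> u \<and> norm u = norm T)"

definition maximizing_sequence ::
    "('a::real_normed_vector \<Rightarrow>\<^sub>L 'b::real_normed_vector) \<Rightarrow> (nat \<Rightarrow> 'a) \<Rightarrow> bool" where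
  "maximizing_sequence T x \<longleftrightarrow> (\<forall>n. norm (x n) = 1) \<and> (\<lambda>n. norm (T (x n))) \<longlonglongrightarrow> norm T"


definition dual ::
    "('k::real_or_complex \<Rightarrow> 'a::real_normed_vector \<Rightarrow> 'a) \<Rightarrow> ('a \<Rightarrow>\<^sub>L 'k) set" where
  "dual sE = operators sE (*)"

definition weakly_null ::
    "('k::real_or_complex \<Rightarrow> 'a::real_normed_vector \<Rightarrow> 'a) \<Rightarrow> (nat \<Rightarrow> 'a) \<Rightarrow> bool" where
  "weakly_null sE x \<longleftrightarrow> (\<forall>f \<in> dual sE. (\<lambda>n. f (x n)) \<longlonglongrightarrow> 0)"

(* The functional c f. *)
definition dual_scale ::
    "'k::real_or_complex \<Rightarrow> ('a::real_normed_vector \<Rightarrow>\<^sub>L 'k) \<Rightarrow> ('a \<Rightarrow>\<^sub>L 'k)" where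
  "dual_scale c f = blinfun_mult_right c o\<^sub>L f"

(* The dual of E is a subset of a type, not a type, so elements of the bidual are functions
   whose values outside the dual of E are fixed to be undefined (extensional). *)
definition bidual ::
    "('k::real_or_complex \<Rightarrow> 'a::real_normed_vector \<Rightarrow> 'a) \<Rightarrow> (('a \<Rightarrow>\<^sub>L 'k) \<Rightarrow> 'k) set" where
  "bidual sE =
     {\<phi> \<in> extensional (dual sE).
        (\<forall>f \<in> dual sE. \<forall>g \<in> dual sE. \<phi> (f + g) = \<phi> f + \<phi> g) \<and>
        (\<forall>c. \<forall>f \<in> dual sE. \<phi> (dual_scale c f) = c * \<phi> f) \<and>
        (\<exists>B. \<forall>f \<in> dual sE. norm (\<phi> f) \<le> B * norm f)}"

definition bidual_norm ::
    "('k::real_or_complex \<Rightarrow> 'a::real_normed_vector \<Rightarrow> 'a) \<Rightarrow> (('a \<Rightarrow>\<^sub>L 'k) \<Rightarrow> 'k) \<Rightarrow> real" where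
  "bidual_norm sE \<phi> = (SUP f \<in> {f \<in> dual sE. norm f \<le> 1}. norm (\<phi> f))"

definition canonical_embedding ::
    "('k::real_or_complex \<Rightarrow> 'a::real_normed_vector \<Rightarrow> 'a) \<Rightarrow> 'a \<Rightarrow> (('a \<Rightarrow>\<^sub>L 'k) \<Rightarrow> 'k)" where
  "canonical_embedding sE x = (\<lambda>f \<in> dual sE. blinfun_apply f x)"

definition reflexive :: "('k::real_or_complex \<Rightarrow> 'a::real_normed_vector \<Rightarrow> 'a) \<Rightarrow> bool" where
  "reflexive sE \<longleftrightarrow> canonical_embedding sE ` UNIV = bidual sE"

definition adjoint_op ::
    "('a::real_normed_vector \<Rightarrow>\<^sub>L 'b::real_normed_vector)
      \<Rightarrow> ('b \<Rightarrow>\<^sub>L 'k::real_or_complex) \<Rightarrow> ('a \<Rightarrow>\<^sub>L 'k)" where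
  "adjoint_op T g = g o\<^sub>L T"

definition second_adjoint ::
    "('k::real_or_complex \<Rightarrow> 'b::real_normed_vector \<Rightarrow> 'b) \<Rightarrow> ('a::real_normed_vector \<Rightarrow>\<^sub>L 'b)
      \<Rightarrow> (('a \<Rightarrow>\<^sub>L 'k) \<Rightarrow> 'k) \<Rightarrow> (('b \<Rightarrow>\<^sub>L 'k) \<Rightarrow> 'k)" where
  "second_adjoint sF T \<phi> = (\<lambda>g \<in> dual sF. \<phi> (adjoint_op T g))"

lemma adjoint_op_in_dual:
  assumes "T \<in> operators sE sF" "g \<in> dual sF"
  shows "adjoint_op T g \<in> dual sE"
proof -
  have "blinfun_apply (adjoint_op T g) = blinfun_apply g \<circ> blinfun_apply T"
    by (auto simp: adjoint_op_def)
  moreover have "Vector_Spaces.linear sE (*) (blinfun_apply g \<circ> blinfun_apply T)"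
    using assms by (intro Vector_Spaces.linear_compose) (auto simp: dual_def operators_def)
  ultimately show ?thesis
    by (simp add: dual_def operators_def)
qed

lemma dual_closed:
  assumes "f \<in> dual sE" "g \<in> dual sE"
  shows "f + g \<in> dual sE" "dual_scale c f \<in> dual sE"
  using assms
  by (auto simp: dual_def operators_def dual_scale_def Vector_Spaces.linear_iff
      plus_blinfun.rep_eq algebra_simps)

lemma second_adjoint_in_bidual:
  fixes sE :: "'k::real_or_complex \<Rightarrow> 'a::real_normed_vector \<Rightarrow> 'a"
    and sF :: "'k \<Rightarrow> 'b::real_normed_vector \<Rightarrow> 'b"
  assumes T: "T \<in> operators sE sF" and \<phi>: "\<phi> \<in> bidual sE"
  shows "second_adjoint sF T \<phi> \<in> bidual sF"
proof -
  obtain B where B: "\<And>f. f \<in> dual sE \<Longrightarrow> norm (\<phi> f) \<le> B * norm f"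
    using \<phi> unfolding bidual_def by blast
  have "norm (\<phi> (adjoint_op T g)) \<le> (\<bar>B\<bar> * norm T) * norm g" if "g \<in> dual sF" for g
  proof -
    have "norm (\<phi> (adjoint_op T g)) \<le> B * norm (adjoint_op T g)"
      by (rule B[OF adjoint_op_in_dual[OF T that]])
    also have "\<dots> \<le> \<bar>B\<bar> * (norm g * norm T)"
      unfolding adjoint_op_def by (intro mult_mono norm_blinfun_compose) auto
    finally show ?thesis by (simp add: mult_ac)
  qed
  moreover have "adjoint_op T (f + g) = adjoint_op T f + adjoint_op T g" for f g :: "'b \<Rightarrow>\<^sub>L 'k"
    by (auto intro!: blinfun_eqI simp: adjoint_op_def plus_blinfun.rep_eq)
  moreover have "adjoint_op T (dual_scale c g) = dual_scale c (adjoint_op T g)"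
    for c and g :: "'b \<Rightarrow>\<^sub>L 'k"
    by (auto intro!: blinfun_eqI simp: adjoint_op_def dual_scale_def)
  ultimately show ?thesis
    using \<phi> by (auto simp: bidual_def second_adjoint_def dual_closed adjoint_op_in_dual[OF T])
qed

lemma canonical_embedding_in_bidual:
  fixes sE :: "'k::real_or_complex \<Rightarrow> 'a::real_normed_vector \<Rightarrow> 'a"
  shows "canonical_embedding sE x \<in> bidual sE"
proof -
  have "norm (blinfun_apply f x) \<le> norm x * norm f" for f :: "'a \<Rightarrow>\<^sub>L 'k"
    using norm_blinfun[of f x] by (simp add: mult.commute)
  moreover have "blinfun_apply (dual_scale c f) x = c * blinfun_apply f x"
    for c and f :: "'a \<Rightarrow>\<^sub>L 'k"
    by (simp add: dual_scale_def)
  ultimately show ?thesis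
    by (auto simp: bidual_def canonical_embedding_def dual_closed plus_blinfun.rep_eq)
qed

definition second_adjoint_norm ::
    "('k::real_or_complex \<Rightarrow> 'a::real_normed_vector \<Rightarrow> 'a) \<Rightarrow> ('k \<Rightarrow> 'b::real_normed_vector \<Rightarrow> 'b)
      \<Rightarrow> ('a \<Rightarrow>\<^sub>L 'b) \<Rightarrow> real" where
  "second_adjoint_norm sE sF T =
     (SUP \<phi> \<in> {\<phi> \<in> bidual sE. bidual_norm sE \<phi> \<le> 1}. bidual_norm sF (second_adjoint sF T \<phi>))"

definition second_adjoint_attains_norm ::
    "('k::real_or_complex \<Rightarrow> 'a::real_normed_vector \<Rightarrow> 'a) \<Rightarrow> ('k \<Rightarrow> 'b::real_normed_vector \<Rightarrow> 'b)
      \<Rightarrow> ('a \<Rightarrow>\<^sub>L 'b) \<Rightarrow> bool" where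
  "second_adjoint_attains_norm sE sF T \<longleftrightarrow>
     (\<exists>\<phi> \<in> bidual sE. bidual_norm sE \<phi> = 1 \<and>
        bidual_norm sF (second_adjoint sF T \<phi>) = second_adjoint_norm sE sF T)"


definition WMP ::
    "('k::real_or_complex \<Rightarrow> 'a::real_normed_vector \<Rightarrow> 'a) \<Rightarrow> ('k \<Rightarrow> 'b::real_normed_vector \<Rightarrow> 'b)
      \<Rightarrow> bool" where
  "WMP sE sF \<longleftrightarrow>
     (\<forall>T \<in> operators sE sF.
        (\<exists>x. maximizing_sequence T x \<and> \<not> weakly_null sE x) \<longrightarrow> attains_norm T)"

definition quasi_WMP ::
    "('k::real_or_complex \<Rightarrow> 'a::real_normed_vector \<Rightarrow> 'a) \<Rightarrow> ('k \<Rightarrow> 'b::real_normed_vector \<Rightarrow> 'b)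
      \<Rightarrow> bool" where
  "quasi_WMP sE sF \<longleftrightarrow>
     (\<forall>T \<in> operators sE sF.
        (\<exists>x. maximizing_sequence T x \<and> \<not> weakly_null sE x) \<longrightarrow> quasi_attains_norm T)"

definition bidual_WMP ::
    "('k::real_or_complex \<Rightarrow> 'a::real_normed_vector \<Rightarrow> 'a) \<Rightarrow> ('k \<Rightarrow> 'b::real_normed_vector \<Rightarrow> 'b)
      \<Rightarrow> bool" where
  "bidual_WMP sE sF \<longleftrightarrow>
     (\<forall>T \<in> operators sE sF.
        (\<exists>x. maximizing_sequence T x \<and> \<not> weakly_null sE x) \<longrightarrow>
          second_adjoint_attains_norm sE sF T)"

end

theory Submission
  imports Defs
begin

text \<open>
  The norm of the second adjoint equals the norm of \<open>T\<close>. If \<open>T x\<^sub>n \<longrightarrow> u\<close> with \<open>u\<close> of maximal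
  norm, then a functional \<open>g\<close> norming \<open>u\<close> has \<open>\<parallel>g \<circ> T\<parallel> = \<parallel>T\<parallel>\<close>, and any element of the bidual norming
  \<open>g \<circ> T\<close> is a point where the second adjoint attains its norm; no compactness is needed.
  Conversely, if \<open>F\<close> is reflexive and the second adjoint attains its norm at \<open>\<phi>\<close>, it sends \<open>\<phi>\<close> to a
  vector \<open>u\<close> of \<open>F\<close>, which by Hahn-Banach is a norm limit of images of vectors of norm
  almost one. If \<open>E\<close> is reflexive, then \<open>\<phi>\<close> itself is a vector of \<open>E\<close>.
\<close>

section \<open>The real Hahn-Banach theorem through minimal sublinear functionals\<close>

text \<open>Homogeneity is demanded only as an inequality, a form that passes directly to infima;
  equality is recovered in \<open>sublinear_scale\<close>.\<close>

definition sublinear :: "('a::real_vector \<Rightarrow> real) \<Rightarrow> bool" where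
  "sublinear p \<longleftrightarrow> (\<forall>x y. p (x + y) \<le> p x + p y) \<and> (\<forall>r\<ge>0. \<forall>x. p (r *\<^sub>R x) \<le> r * p x)"

lemma sublinear_add: "sublinear p \<Longrightarrow> p (x + y) \<le> p x + p y"
  and sublinear_scale_le: "sublinear p \<Longrightarrow> 0 \<le> r \<Longrightarrow> p (r *\<^sub>R x) \<le> r * p x"
  by (auto simp: sublinear_def)

lemma sublinear_zero: "sublinear p \<Longrightarrow> p 0 = 0"
  using sublinear_add[of p 0 0] sublinear_scale_le[of p 0 0] by simp

lemma sublinear_scale:
  assumes "sublinear p" "0 \<le> r"
  shows "p (r *\<^sub>R x) = r * p x"
proof (cases "r = 0")
  case False
  then have "p x \<le> inverse r * p (r *\<^sub>R x)"
    using sublinear_scale_le[OF assms(1), of "inverse r" "r *\<^sub>R x"] assms(2) by simp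
  then have "r * p x \<le> p (r *\<^sub>R x)"
    using False assms(2) by (simp add: field_simps)
  then show ?thesis
    using sublinear_scale_le[OF assms, of x] by simp
qed (simp add: sublinear_zero[OF assms(1)])

lemma sublinear_minus: "sublinear p \<Longrightarrow> - p (- x) \<le> p x"
  using sublinear_add[of p x "- x"] sublinear_zero[of p] by simp

text \<open>
  The largest sublinear \<open>q \<le> p\<close> with \<open>q (- v) \<le> - p v\<close>. Minimality of \<open>p\<close> forces \<open>tilt p v = p\<close>, hence linearity; tilting along \<open>u\<close> also forces the value at \<open>u\<close>.
\<close>

definition tilt :: "('a::real_vector \<Rightarrow> real) \<Rightarrow> 'a \<Rightarrow> 'a \<Rightarrow> real" where
  "tilt p v x = (INF t\<in>{0..}. p (x + t *\<^sub>R v) - t * p v)"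

lemma tilt_le:
  assumes "sublinear p" "0 \<le> t"
  shows "tilt p v x \<le> p (x + t *\<^sub>R v) - t * p v"
proof -
  \<comment> \<open>Subadditivity at \<open>x + s *\<^sub>R v\<close> and \<open>- x\<close> gives a
    lower bound free of \<open>s\<close>, so the infimum is finite.\<close>
  have "- p (- x) \<le> p (x + s *\<^sub>R v) - s * p v" if "0 \<le> s" for s
    using sublinear_add[OF assms(1), of "x + s *\<^sub>R v" "- x"] sublinear_scale[OF assms(1) that, of v]
    by simp
  then have "bdd_below ((\<lambda>t. p (x + t *\<^sub>R v) - t * p v) ` {0..})"
    by (intro bdd_belowI[of _ "- p (- x)"]) auto
  then show ?thesis
    unfolding tilt_def using assms(2) by (intro cINF_lower) auto
qed

lemma le_tiltI: "(\<And>t. 0 \<le> t \<Longrightarrow> c \<le> p (x + t *\<^sub>R v) - t * p v) \<Longrightarrow> c \<le> tilt p v x"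
  unfolding tilt_def by (rule cINF_greatest) auto

lemma sublinear_tilt:
  assumes p: "sublinear p"
  shows "sublinear (tilt p v)"
  unfolding sublinear_def
proof (intro conjI allI impI)
  fix x y
  \<comment> \<open>Parameters \<open>s\<close> for \<open>x\<close> and \<open>t\<close> for
    \<open>y\<close> combine to \<open>s + t\<close> for \<open>x + y\<close>; the two infima are
    then taken one at a time.\<close>
  have "tilt p v (x + y) - (p (x + s *\<^sub>R v) - s * p v) \<le> p (y + t *\<^sub>R v) - t * p v"
    if "0 \<le> s" "0 \<le> t" for s t
    using tilt_le[OF p, of "s + t" v "x + y"] that
      sublinear_add[OF p, of "x + s *\<^sub>R v" "y + t *\<^sub>R v"]
    by (simp add: algebra_simps)
  then have "tilt p v (x + y) - (p (x + s *\<^sub>R v) - s * p v) \<le> tilt p v y" if "0 \<le> s" for s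
    using that by (intro le_tiltI) auto
  then have "tilt p v (x + y) - tilt p v y \<le> tilt p v x"
    by (intro le_tiltI) (simp add: algebra_simps)
  then show "tilt p v (x + y) \<le> tilt p v x + tilt p v y" by simp
next
  fix r :: real and x assume r: "0 \<le> r"
  show "tilt p v (r *\<^sub>R x) \<le> r * tilt p v x"
  proof (cases "r = 0")
    case True
    then show ?thesis using tilt_le[OF p, of 0 v 0] by (simp add: sublinear_zero[OF p])
  next
    case False
    \<comment> \<open>The parameter \<open>t\<close> at \<open>x\<close> corresponds to
      \<open>r * t\<close> at \<open>r *\<^sub>R x\<close>, so the whole expression scales by
      \<open>r\<close>.\<close>
    have "tilt p v (r *\<^sub>R x) / r \<le> p (x + t *\<^sub>R v) - t * p v" if "0 \<le> t" for t
    proof -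
      have "tilt p v (r *\<^sub>R x) \<le> p (r *\<^sub>R (x + t *\<^sub>R v)) - (r * t) * p v"
        using tilt_le[OF p, of "r * t" v "r *\<^sub>R x"] r that by (simp add: scaleR_add_right)
      then show ?thesis
        using False r sublinear_scale[OF p r, of "x + t *\<^sub>R v"] by (simp add: field_simps)
    qed
    then have "tilt p v (r *\<^sub>R x) / r \<le> tilt p v x" by (rule le_tiltI)
    then show ?thesis using False r by (simp add: field_simps)
  qed
qed

lemma tilt_le_self: "sublinear p \<Longrightarrow> tilt p v x \<le> p x"
  using tilt_le[of p 0 v x] by simp

text \<open>Zorn's lemma applies because the pointwise infimum of a nonempty chain is again
  sublinear.\<close>

lemma minimal_sublinear_exists:
  fixes p :: "'a::real_vector \<Rightarrow> real"
  assumes p: "sublinear p"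
  shows "\<exists>m. sublinear m \<and> m \<le> p \<and> (\<forall>q. sublinear q \<longrightarrow> q \<le> m \<longrightarrow> q = m)"
proof -
  define A where "A = {q. sublinear q \<and> q \<le> p}"
  \<comment> \<open>The order is reversed, so that the maximal elements of Zorn's lemma are minimal
    functionals.\<close>
  have po: "partial_order_on A (relation_of (\<ge>) A)"
    by (auto intro!: partial_order_on_relation_ofI)
  have "\<exists>m\<in>A. \<forall>a\<in>A. a \<le> m \<longrightarrow> a = m"
  proof (rule predicate_Zorn[OF po])
    fix C assume C: "C \<in> Chains (relation_of (\<ge>) A)"
    then have CA: "C \<subseteq> A" by (auto simp: Chains_def relation_of_def)
    have total: "q \<le> q' \<or> q' \<le> q" if "q \<in> C" "q' \<in> C" for q q'
      using C that by (auto simp: Chains_def relation_of_def)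
    show "\<exists>u\<in>A. \<forall>a\<in>C. u \<le> a"
    proof (cases "C = {}")
      case True
      then show ?thesis using p by (auto simp: A_def)
    next
      case False
      define w where "w = (\<lambda>x. INF q\<in>C. q x)"
      have "- p (- x) \<le> q x" if "q \<in> C" for q x
      proof -
        have "sublinear q" "q (- x) \<le> p (- x)" using CA that by (auto simp: A_def le_fun_def)
        then show ?thesis using sublinear_minus[of q x] by simp
      qed
      then have bdd: "bdd_below ((\<lambda>q. q x) ` C)" for x
        by (intro bdd_belowI[of _ "- p (- x)"]) auto
      have w_le: "w x \<le> q x" if "q \<in> C" for q x
        unfolding w_def using bdd that by (intro cINF_lower)
      have le_w: "c \<le> w x" if "\<And>q. q \<in> C \<Longrightarrow> c \<le> q x" for c x
        unfolding w_def using False that by (intro cINF_greatest)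
      have sub: "sublinear q" if "q \<in> C" for q using CA that by (auto simp: A_def)
      have "w (x + y) \<le> w x + w y" for x y
      proof -
        \<comment> \<open>Of two members of a chain, the smaller one can be used at both
          points.\<close>
        have "w (x + y) \<le> q1 x + q2 y" if q: "q1 \<in> C" "q2 \<in> C" for q1 q2
        proof -
          have "w (x + y) \<le> q1 x + q1 y" "w (x + y) \<le> q2 x + q2 y"
            using w_le sublinear_add[OF sub] q order_trans by blast+
          then show ?thesis
            using total[OF q] by (smt (verit) le_fun_def)
        qed
        then have "w (x + y) - q1 x \<le> w y" if "q1 \<in> C" for q1
          by (intro le_w) (use that in \<open>fastforce simp: diff_le_eq add.commute\<close>)
        then have "w (x + y) - w y \<le> w x" by (intro le_w) (simp add: algebra_simps)
        then show ?thesis by simp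
      qed
      moreover have "w (r *\<^sub>R x) \<le> r * w x" if r: "0 \<le> r" for r x
      proof -
        have *: "w (r *\<^sub>R x) \<le> r * q x" if "q \<in> C" for q
          using w_le[OF that, of "r *\<^sub>R x"] sublinear_scale_le[OF sub[OF that] r, of x] by simp
        show ?thesis
        proof (cases "r = 0")
          case True
          then show ?thesis using * False by auto
        next
          case False
          then have "w (r *\<^sub>R x) / r \<le> w x" using * r by (intro le_w) (simp add: field_simps)
          then show ?thesis using False r by (simp add: field_simps)
        qed
      qed
      ultimately have "sublinear w" by (simp add: sublinear_def)
      moreover obtain q where "q \<in> C" using False by blast
      then have "w \<le> q" "q \<le> p" using w_le CA by (auto simp: le_fun_def A_def)
      then have "w \<le> p" by (rule order_trans)
      ultimately show ?thesis using w_le by (auto simp: A_def le_fun_def)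
    qed
  qed
  then obtain m where m: "m \<in> A" "\<And>a. a \<in> A \<Longrightarrow> a \<le> m \<Longrightarrow> a = m" by blast
  have "q = m" if "sublinear q" "q \<le> m" for q
    using m that by (auto simp: A_def intro: order_trans)
  then show ?thesis using m(1) by (auto simp: A_def)
qed

lemma minimal_sublinear_linear:
  assumes m: "sublinear m" and min: "\<And>q. sublinear q \<Longrightarrow> q \<le> m \<Longrightarrow> q = m"
  shows "linear m"
proof -
  have tilt: "tilt m v = m" for v
    by (rule min) (auto simp: sublinear_tilt[OF m] le_fun_def tilt_le_self[OF m])
  \<comment> \<open>With \<open>t = 1\<close> the tilted inequality reads
    \<open>m x \<le> m (x + v) - m v\<close>, the reverse of subadditivity.\<close>
  have add: "m (x + v) = m x + m v" for x v
    using tilt_le[OF m, of 1 v x] sublinear_add[OF m, of x v] by (simp add: tilt)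
  have neg: "m (- x) = - m x" for x
    using add[of x "- x"] sublinear_zero[OF m] by simp
  have "m (r *\<^sub>R x) = r * m x" for r x
    using sublinear_scale[OF m, of r x] sublinear_scale[OF m, of "- r" x] neg[of "r *\<^sub>R x"]
    by (cases "0 \<le> r") auto
  with add show ?thesis by (auto intro!: linearI)
qed

lemma real_hahn_banach:
  fixes p :: "'a::real_vector \<Rightarrow> real"
  assumes p: "sublinear p"
  shows "\<exists>h. linear h \<and> (\<forall>x. h x \<le> p x) \<and> h u = p u"
proof -
  obtain h where h: "sublinear h" "h \<le> tilt p u" "\<forall>q. sublinear q \<longrightarrow> q \<le> h \<longrightarrow> q = h"
    using minimal_sublinear_exists[OF sublinear_tilt[OF p]] by blast
  then have lin: "linear h" using minimal_sublinear_linear by blast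
  have le: "h x \<le> p x" for x
    using h(2) tilt_le_self[OF p, of u x] by (auto simp: le_fun_def intro: order_trans)
  \<comment> \<open>At \<open>- u\<close> the choice \<open>t = 1\<close> in the tilt leaves
    \<open>p 0 - p u\<close>, and linearity turns this upper bound into a lower bound for
    \<open>h u\<close>.\<close>
  have "h (- u) \<le> tilt p u (- u)" using h(2) by (simp add: le_fun_def)
  also have "\<dots> \<le> - p u"
    using tilt_le[OF p, of 1 u "- u"] by (simp add: sublinear_zero[OF p])
  finally have "p u \<le> h u" by (simp add: linear_neg[OF lin])
  with le lin show ?thesis by (intro exI[of _ h]) (auto intro: antisym)
qed

section \<open>Functionals over the scalar field and the Hahn-Banach theorem for seminorms\<close>

text \<open>The axioms of \<open>banach_over\<close> on a merely normed type: the locale serves for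
  E and F and again for the functionals under \<open>dual_scale\<close>.\<close>

locale normed_over = vector_space scale
  for scale :: "'k::real_or_complex \<Rightarrow> 'a::real_normed_vector \<Rightarrow> 'a" +
  assumes scale_of_real: "scale (of_real r) x = r *\<^sub>R x"
    and norm_scale: "norm (scale c x) = norm c * norm x"

lemma (in banach_over) normed_over: "normed_over scale"
  by unfold_locales (rule scale_of_real norm_scale)+

lemma vector_space_mult: "vector_space ((*) :: 'k::field \<Rightarrow> 'k \<Rightarrow> 'k)"
  by unfold_locales (auto simp: algebra_simps)

text \<open>Identities pull back along the isometry of the class, which is injective; in the second
  case \<open>i\<close> is the preimage of the imaginary unit.\<close>

lemma real_or_complex_cases:
  obtains (real) "\<And>c::'k::real_or_complex. \<exists>r. c = of_real r"
  | (complex) i :: "'k::real_or_complex" where "i * i = - 1"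
      "\<And>c::'k::real_or_complex. \<exists>a b. c = of_real a + i * of_real b"
      "\<And>a b. norm (of_real a + i * of_real b) = sqrt (a\<^sup>2 + b\<^sup>2)"
proof -
  obtain \<phi> :: "'k \<Rightarrow> complex" where add: "\<And>x y. \<phi> (x + y) = \<phi> x + \<phi> y"
    and mult: "\<And>x y. \<phi> (x * y) = \<phi> x * \<phi> y"
    and scale: "\<And>r x. \<phi> (r *\<^sub>R x) = r *\<^sub>R \<phi> x" and one: "\<phi> 1 = 1"
    and norm: "\<And>x. norm (\<phi> x) = norm x" and range: "range \<phi> = \<real> \<or> range \<phi> = UNIV"
    using real_or_complex[where 'a='k] by blast
  have lin: "linear \<phi>" by (intro linearI add scale)
  have inj: "x = y" if "\<phi> x = \<phi> y" for x y
    using norm[of "x - y"] that by (simp add: linear_diff[OF lin])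
  have of_real: "\<phi> (of_real r) = of_real r" for r
    by (simp add: of_real_def scale one)
  from range show thesis
  proof
    assume R: "range \<phi> = \<real>"
    have "\<exists>r. c = of_real r" for c :: 'k
    proof -
      have "\<phi> c \<in> \<real>" using R by blast
      then obtain r where "\<phi> c = of_real r" by (auto elim: Reals_cases)
      then have "c = of_real r" by (intro inj) (simp add: of_real)
      then show ?thesis ..
    qed
    then show thesis by (rule real)
  next
    assume U: "range \<phi> = UNIV"
    then obtain i where i: "\<phi> i = \<i>" by (metis surj_def)
    show thesis
    proof (rule complex)
      show "i * i = - 1"
        by (rule inj) (simp add: mult i linear_neg[OF lin] one)
      show "\<exists>a b. c = of_real a + i * of_real b" for c :: 'k
        by (rule exI[of _ "Re (\<phi> c)"], rule exI[of _ "Im (\<phi> c)"], rule inj)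
          (simp add: add mult i of_real complex_eq[symmetric])
      show "norm (of_real a + i * of_real b) = sqrt (a\<^sup>2 + b\<^sup>2)" for a b
        using norm[of "of_real a + i * of_real b"]
        by (simp add: add mult i of_real cmod_def)
    qed
  qed
qed

context normed_over
begin

lemma dualI:
  fixes f :: "'a \<Rightarrow> 'k"
  assumes add: "\<And>x y. f (x + y) = f x + f y" and scale: "\<And>c x. f (scale c x) = c * f x"
    and bound: "\<And>x. norm (f x) \<le> norm x * B"
  shows "Blinfun f \<in> dual scale" "blinfun_apply (Blinfun f) = f"
proof -
  have "f (r *\<^sub>R x) = r *\<^sub>R f x" for r x
    using scale[of "of_real r" x] by (simp add: scale_of_real scaleR_conv_of_real)
  then have "bounded_linear f" using add bound by (intro bounded_linear_intro)
  then show *: "blinfun_apply (Blinfun f) = f" by (rule bounded_linear_Blinfun_apply)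
  show "Blinfun f \<in> dual scale"
    using vector_space_axioms vector_space_mult add scale
    by (simp add: dual_def operators_def * Vector_Spaces.linear_iff)
qed

lemma dual_add: "f \<in> dual scale \<Longrightarrow> blinfun_apply f (x + y) = f x + f y"
  and dual_scale_apply: "f \<in> dual scale \<Longrightarrow> blinfun_apply f (scale c x) = c * f x"
  by (auto simp: dual_def operators_def Vector_Spaces.linear_iff)

text \<open>The real theorem supplies the real part \<open>h\<close>, from which the functional is
  rebuilt. A general seminorm is allowed because a gauge on F is used later; \<open>B\<close> makes
  the functional bounded.\<close>

lemma hahn_banach_seminorm:
  assumes p_add: "\<And>x y. p (x + y) \<le> p x + p y" and p_scale: "\<And>c x. p (scale c x) = norm c * p x"
    and p_le: "\<And>x. p x \<le> norm x * B"
  shows "\<exists>f\<in>dual scale. (\<forall>x. norm (blinfun_apply f x) \<le> p x) \<and> blinfun_apply f u = of_real (p u)"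
proof -
  have p_real: "p (r *\<^sub>R x) = \<bar>r\<bar> * p x" for r x
    using p_scale[of "of_real r" x] by (simp add: scale_of_real)
  then have p_minus: "p (- x) = p x" for x
    using p_real[of "- 1" x] by simp
  have "sublinear p" using p_add by (auto simp: sublinear_def p_real)
  then obtain h where lin: "linear h" and le: "\<And>x. h x \<le> p x" and hu: "h u = p u"
    using real_hahn_banach by blast
  have abs_le: "\<bar>h x\<bar> \<le> p x" for x
    using le[of x] le[of "- x"] by (simp add: p_minus linear_neg[OF lin] abs_le_iff)
  show ?thesis
  proof (cases rule: real_or_complex_cases[where 'k='k])
    case real
    define f where "f = (\<lambda>x. of_real (h x) :: 'k)"
    have "f (scale c x) = c * f x" for c x
    proof -
      obtain r where "c = of_real r" using real by blast
      then show ?thesis by (simp add: scale_of_real f_def linear_scale[OF lin])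
    qed
    moreover have "f (x + y) = f x + f y" for x y by (simp add: f_def linear_add[OF lin])
    moreover have "norm (f x) \<le> p x" for x using abs_le by (simp add: f_def)
    moreover from this have "norm (f x) \<le> norm x * B" for x using p_le order_trans by blast
    ultimately show ?thesis
      using dualI[of f B] by (intro bexI[of _ "Blinfun f"]) (auto simp: f_def hu)
  next
    case (complex i)
    \<comment> \<open>A complex-linear functional is determined by its real part: its imaginary part
      at \<open>x\<close> is minus the real part at \<open>scale i x\<close>.\<close>
    define f where "f = (\<lambda>x. of_real (h x) - i * of_real (h (scale i x)) :: 'k)"
    have ii: "scale i (scale i x) = - x" for x
      using complex(1) by (simp add: scale_minus_left)
    have comm: "scale i (r *\<^sub>R x) = r *\<^sub>R scale i x" for r x
      by (simp add: scale_of_real[symmetric] mult.commute)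
    have f_add: "f (x + y) = f x + f y" for x y
      by (simp add: f_def linear_add[OF lin] scale_right_distrib algebra_simps)
    have f_real: "f (r *\<^sub>R x) = of_real r * f x" for r x
      by (simp add: f_def linear_scale[OF lin] comm algebra_simps)
    have f_i: "f (scale i x) = i * f x" for x
    proof -
      have "i * f x = i * of_real (h x) - (i * i) * of_real (h (scale i x))"
        by (simp add: f_def algebra_simps)
      then show ?thesis by (simp add: complex(1)) (simp add: f_def ii linear_neg[OF lin] del: scale_scale)
    qed
    have f_scale: "f (scale c x) = c * f x" for c x
    proof -
      obtain a b where "c = of_real a + i * of_real b" using complex(2) by blast
      then show ?thesis
        by (simp add: scale_left_distrib f_add scale_of_real f_real f_i scale_scale[symmetric]
            algebra_simps del: scale_scale)
    qed
    have f_le: "norm (f x) \<le> p x" for x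
    proof (cases "f x = 0")
      case True
      then show ?thesis using abs_le[of x] by simp
    next
      case False
      \<comment> \<open>\<open>c\<close> rotates \<open>f x\<close> onto the positive reals, so the
        modulus is the value of \<open>h\<close> at the rotated vector, where
        \<open>h \<le> p\<close>.\<close>
      define c where "c = of_real (norm (f x)) / f x"
      have nc: "norm c = 1" using False by (simp add: c_def norm_divide)
      have "of_real (norm (f x)) = f (scale c x)"
        using False by (simp add: f_scale c_def)
      also have "\<dots> = of_real (h (scale c x)) - i * of_real (h (scale i (scale c x)))"
        by (simp add: f_def)
      finally have "of_real (norm (f x) - h (scale c x)) + i * of_real (h (scale i (scale c x))) = 0"
        by (simp add: algebra_simps)
      then have "norm (f x) = h (scale c x)"
        using complex(3)[of "norm (f x) - h (scale c x)" "h (scale i (scale c x))"]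
        by (simp add: real_sqrt_eq_0_iff sum_power2_eq_zero_iff)
      then show ?thesis using le[of "scale c x"] by (simp add: p_scale nc)
    qed
    have "norm (f x) \<le> norm x * B" for x using f_le p_le order_trans by blast
    note * = dualI[of f, OF f_add f_scale this]
    \<comment> \<open>The real part at \<open>u\<close> is already \<open>p u\<close> and the
      modulus is at most \<open>p u\<close>, so the imaginary part vanishes.\<close>
    have "f u = of_real (p u)"
    proof -
      have "p u = \<bar>p u\<bar>" using abs_le[of u] by simp
      moreover have "sqrt ((p u)\<^sup>2 + (h (scale i u))\<^sup>2) \<le> p u"
        using f_le[of u] complex(3)[of "h u" "- h (scale i u)"] by (simp add: f_def hu)
      ultimately have "(h (scale i u))\<^sup>2 \<le> 0"
        using real_sqrt_le_iff[of "(p u)\<^sup>2 + (h (scale i u))\<^sup>2" "(p u)\<^sup>2"] by simp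
      then show ?thesis by (simp add: f_def hu)
    qed
    then show ?thesis using * f_le by (intro bexI[of _ "Blinfun f"]) auto
  qed
qed


lemma zero_in_dual: "0 \<in> dual scale"
  using vector_space_axioms vector_space_mult
  by (simp add: dual_def operators_def Vector_Spaces.linear_iff)

text \<open>Hahn-Banach with the norm itself as seminorm. The bound \<open>norm f \<le> 1\<close>,
  instead of equality, also covers the zero space.\<close>

lemma norming_functional: "\<exists>f\<in>dual scale. norm f \<le> 1 \<and> blinfun_apply f u = of_real (norm u)"
proof -
  obtain f where "f \<in> dual scale" "\<And>x. norm (blinfun_apply f x) \<le> norm x"
      "blinfun_apply f u = of_real (norm u)"
    using hahn_banach_seminorm[of norm 1 u] norm_triangle_ineq norm_scale by auto
  then show ?thesis by (intro bexI[of _ f]) (auto intro: norm_blinfun_bound)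
qed

end

section \<open>The normed structure on functionals, and the bidual norm\<close>

lemma dual_scale_eval: "blinfun_apply (dual_scale c f) x = c * f x"
  by (simp add: dual_scale_def)

text \<open>The scaling acts on the whole type of bounded real-linear maps, of which the dual is a
  subset; this opens Hahn-Banach to functionals on functionals.\<close>

lemma normed_over_dual_scale:
  "normed_over (dual_scale :: 'k::real_or_complex \<Rightarrow> ('a::real_normed_vector \<Rightarrow>\<^sub>L 'k) \<Rightarrow> _)"
proof unfold_locales
  fix c d :: 'k and f g :: "'a \<Rightarrow>\<^sub>L 'k" and r :: real
  show "dual_scale c (f + g) = dual_scale c f + dual_scale c g"
    and "dual_scale (c + d) f = dual_scale c f + dual_scale d f"
    and "dual_scale 1 f = f" and "dual_scale (of_real r) f = r *\<^sub>R f"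
    and scale_scale: "dual_scale c (dual_scale d f) = dual_scale (c * d) f"
    by (auto intro!: blinfun_eqI
        simp: dual_scale_eval plus_blinfun.rep_eq scaleR_blinfun.rep_eq scaleR_conv_of_real algebra_simps)
  have le: "norm (dual_scale b h) \<le> norm b * norm h" for b :: 'k and h :: "'a \<Rightarrow>\<^sub>L 'k"
    using norm_blinfun[of h]
    by (intro norm_blinfun_bound) (auto simp: dual_scale_eval norm_mult mult.assoc mult_left_mono)
  show "norm (dual_scale c f) = norm c * norm f"
  proof (cases "c = 0")
    case True
    then show ?thesis using le[of 0 f] by simp
  next
    case False
    \<comment> \<open>The bound \<open>le\<close> for the inverse scalar gives the reverse
      inequality.\<close>
    then have "f = dual_scale (inverse c) (dual_scale c f)"
      by (auto intro!: blinfun_eqI simp: dual_scale_eval)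
    then have "norm f \<le> norm (inverse c) * norm (dual_scale c f)"
      using le by metis
    then have "norm c * norm f \<le> norm (dual_scale c f)"
      using False by (simp add: norm_divide field_simps)
    then show ?thesis using le[of c f] by simp
  qed
qed

context normed_over
begin

lemma bidual_norm_upper:
  assumes "\<phi> \<in> bidual scale" "f \<in> dual scale" "norm f \<le> 1"
  shows "norm (\<phi> f) \<le> bidual_norm scale \<phi>"
proof -
  obtain B where B: "\<And>g. g \<in> dual scale \<Longrightarrow> norm (\<phi> g) \<le> B * norm g"
    using assms(1) unfolding bidual_def by blast
  have "norm (\<phi> g) \<le> \<bar>B\<bar>" if "g \<in> dual scale" "norm g \<le> 1" for g
  proof -
    have "norm (\<phi> g) \<le> B * norm g" by (rule B[OF that(1)])
    also have "\<dots> \<le> \<bar>B\<bar> * 1" using that(2) by (intro mult_mono) auto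
    finally show ?thesis by simp
  qed
  then have "bdd_above ((\<lambda>g. norm (\<phi> g)) ` {g \<in> dual scale. norm g \<le> 1})"
    by (intro bdd_aboveI[of _ "\<bar>B\<bar>"]) auto
  then show ?thesis
    unfolding bidual_norm_def using assms by (intro cSUP_upper) auto
qed

lemma bidual_apply_le:
  assumes \<phi>: "\<phi> \<in> bidual scale" and f: "f \<in> dual scale"
  shows "norm (\<phi> f) \<le> bidual_norm scale \<phi> * norm f"
proof (cases "f = 0")
  case True
  have "\<phi> (0 + 0) = \<phi> 0 + \<phi> 0" using \<phi> zero_in_dual unfolding bidual_def by blast
  then show ?thesis using True by simp
next
  case False
  interpret D: normed_over "dual_scale :: 'k \<Rightarrow> ('a \<Rightarrow>\<^sub>L 'k) \<Rightarrow> _"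
    by (rule normed_over_dual_scale)
  define c :: 'k where "c = of_real (inverse (norm f))"
  have "norm (\<phi> (dual_scale c f)) \<le> bidual_norm scale \<phi>"
    using False by (intro bidual_norm_upper \<phi> dual_closed(2)[OF f f])
      (simp add: D.norm_scale c_def norm_inverse)
  moreover have "\<phi> (dual_scale c f) = c * \<phi> f" using \<phi> f by (simp add: bidual_def)
  ultimately show ?thesis
    using False by (simp add: c_def norm_mult norm_divide divide_inverse[symmetric] pos_divide_le_eq
        mult.commute[of "inverse _"])
qed

lemma bidual_norm_le:
  assumes "\<And>f. f \<in> dual scale \<Longrightarrow> norm f \<le> 1 \<Longrightarrow> norm (\<phi> f) \<le> B"
  shows "bidual_norm scale \<phi> \<le> B"
  unfolding bidual_norm_def
  by (rule cSUP_least) (use assms zero_in_dual in \<open>auto intro!: exI[of _ 0]\<close>)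

lemma bidual_norm_canonical_embedding:
  "bidual_norm scale (canonical_embedding scale x) = norm x"
proof (rule antisym)
  show "bidual_norm scale (canonical_embedding scale x) \<le> norm x"
  proof (rule bidual_norm_le)
    fix f :: "'a \<Rightarrow>\<^sub>L 'k" assume f: "f \<in> dual scale" "norm f \<le> 1"
    have "norm (f x) \<le> norm f * norm x" by (rule norm_blinfun)
    also have "\<dots> \<le> 1 * norm x" using f by (intro mult_right_mono) auto
    finally show "norm (canonical_embedding scale x f) \<le> norm x"
      using f by (simp add: canonical_embedding_def)
  qed
  let ?J = "canonical_embedding scale x"
  obtain f where f: "f \<in> dual scale" "norm f \<le> 1" "blinfun_apply f x = of_real (norm x)"
    using norming_functional by blast
  show "norm x \<le> bidual_norm scale ?J"
    using bidual_norm_upper[OF canonical_embedding_in_bidual f(1,2), of x] f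
    by (simp add: canonical_embedding_def)
qed

text \<open>Hahn-Banach is applied on the whole type of bounded real-linear maps, and the result is
  restricted to the dual. The value at \<open>h \<noteq> 0\<close> forces the norm up to 1.\<close>

lemma bidual_norming:
  assumes h: "h \<in> dual scale" "h \<noteq> 0"
  shows "\<exists>\<phi>\<in>bidual scale. bidual_norm scale \<phi> = 1 \<and> \<phi> h = of_real (norm h)"
proof -
  interpret D: normed_over "dual_scale :: 'k \<Rightarrow> ('a \<Rightarrow>\<^sub>L 'k) \<Rightarrow> _"
    by (rule normed_over_dual_scale)
  obtain \<Phi> where \<Phi>: "\<Phi> \<in> dual dual_scale" "norm \<Phi> \<le> 1" "blinfun_apply \<Phi> h = of_real (norm h)"
    using D.norming_functional by blast
  define \<phi> where "\<phi> = (\<lambda>f\<in>dual scale. \<Phi> f)"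
  have le: "norm (\<Phi> f) \<le> 1 * norm f" for f
    using norm_blinfun[of \<Phi> f] mult_right_mono[OF \<Phi>(2), of "norm f"] by simp
  have \<phi>: "\<phi> \<in> bidual scale"
    using le by (auto simp: bidual_def \<phi>_def dual_closed D.dual_add[OF \<Phi>(1)]
        D.dual_scale_apply[OF \<Phi>(1)] intro!: exI[of _ 1])
  have \<phi>h: "\<phi> h = of_real (norm h)" using h \<Phi> by (simp add: \<phi>_def)
  have "bidual_norm scale \<phi> \<le> 1"
    using le by (intro bidual_norm_le) (fastforce simp: \<phi>_def intro: order_trans)
  moreover have "1 \<le> bidual_norm scale \<phi>"
    using bidual_apply_le[OF \<phi> h(1)] h(2) \<phi>h by simp
  ultimately show ?thesis using \<phi> \<phi>h by (auto intro: antisym)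
qed

end

section \<open>Second adjoints and their norms\<close>

locale operator_over = E: normed_over sE + F: normed_over sF
  for sE :: "'k::real_or_complex \<Rightarrow> 'a::real_normed_vector \<Rightarrow> 'a"
    and sF :: "'k \<Rightarrow> 'b::real_normed_vector \<Rightarrow> 'b" +
  fixes T :: "'a \<Rightarrow>\<^sub>L 'b"
  assumes T: "T \<in> operators sE sF"
begin

lemma T_scale: "T (sE c x) = sF c (T x)"
  using T by (simp add: operators_def Vector_Spaces.linear_iff)

lemma norm_adjoint_op_le: "norm (adjoint_op T g) \<le> norm T * norm g"
  using norm_blinfun_compose[of g T] by (simp add: adjoint_op_def mult.commute)

lemma second_adjoint_canonical_embedding:
  "second_adjoint sF T (canonical_embedding sE x) = canonical_embedding sF (T x)"
  unfolding second_adjoint_def canonical_embedding_def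
  by (rule restrict_ext) (simp add: adjoint_op_in_dual[OF T], simp add: adjoint_op_def)

lemma bidual_norm_second_adjoint_le:
  assumes "\<phi> \<in> bidual sE" "bidual_norm sE \<phi> \<le> 1"
  shows "bidual_norm sF (second_adjoint sF T \<phi>) \<le> norm T"
proof (rule F.bidual_norm_le)
  fix g assume g: "g \<in> dual sF" "norm g \<le> 1"
  have "norm (\<phi> (adjoint_op T g)) \<le> bidual_norm sE \<phi> * norm (adjoint_op T g)"
    by (rule E.bidual_apply_le[OF assms(1) adjoint_op_in_dual[OF T g(1)]])
  also have "\<dots> \<le> 1 * (norm T * norm g)"
    using assms(2) norm_adjoint_op_le by (intro mult_mono) auto
  also have "\<dots> \<le> norm T" using g(2) by (simp add: mult_left_le)
  finally show "norm (second_adjoint sF T \<phi> g) \<le> norm T"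
    using g by (simp add: second_adjoint_def)
qed

text \<open>For the lower bound the supremum is tested on embedded vectors, where the second adjoint
  acts as \<open>T\<close> and the embedding is isometric.\<close>

lemma second_adjoint_norm: "second_adjoint_norm sE sF T = norm T"
proof (rule antisym)
  let ?B = "{\<phi> \<in> bidual sE. bidual_norm sE \<phi> \<le> 1}"
  have J: "canonical_embedding sE x \<in> ?B" if "norm x \<le> 1" for x
    using that by (simp add: canonical_embedding_in_bidual E.bidual_norm_canonical_embedding)
  show "second_adjoint_norm sE sF T \<le> norm T"
    unfolding second_adjoint_norm_def
    by (rule cSUP_least) (use J[of 0] bidual_norm_second_adjoint_le in auto)
  have "bdd_above ((\<lambda>\<phi>. bidual_norm sF (second_adjoint sF T \<phi>)) ` ?B)"
    using bidual_norm_second_adjoint_le by (intro bdd_aboveI[of _ "norm T"]) auto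
  then have "bidual_norm sF (second_adjoint sF T (canonical_embedding sE x))
      \<le> second_adjoint_norm sE sF T" if "norm x \<le> 1" for x
    unfolding second_adjoint_norm_def using J[OF that] by (rule cSUP_upper[rotated])
  then have le: "norm (T x) \<le> second_adjoint_norm sE sF T" if "norm x \<le> 1" for x
    using that by (simp add: second_adjoint_canonical_embedding F.bidual_norm_canonical_embedding)
  show "norm T \<le> second_adjoint_norm sE sF T"
  proof (rule norm_blinfun_bound)
    show "0 \<le> second_adjoint_norm sE sF T" using le[of 0] by simp
    show "norm (T x) \<le> second_adjoint_norm sE sF T * norm x" for x
    proof (cases "x = 0")
      case False
      then show ?thesis using le[of "inverse (norm x) *\<^sub>R x"]
        by (simp add: blinfun.scaleR_right field_simps)
    qed simp
  qed
qed

section \<open>Norm attainment of an operator and of its second adjoint\<close>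

lemma quasi_attains_norm_imp_second_adjoint:
  assumes "quasi_attains_norm T"
  shows "second_adjoint_attains_norm sE sF T"
proof -
  obtain x u where x: "\<And>n::nat. norm (x n) = 1" and lim: "(\<lambda>n. T (x n)) \<longlonglongrightarrow> u"
    and u: "norm u = norm T"
    using assms by (auto simp: quasi_attains_norm_def)
  obtain \<phi> where \<phi>: "\<phi> \<in> bidual sE" "bidual_norm sE \<phi> = 1"
    and le: "norm T \<le> bidual_norm sF (second_adjoint sF T \<phi>)"
  proof (cases "T = 0")
    \<comment> \<open>For \<open>T = 0\<close> the composite \<open>adjoint_op T g\<close> vanishes,
      which \<open>bidual_norming\<close> excludes; any embedded unit vector works.\<close>
    case True
    let ?J = "canonical_embedding sE (x 0)"
    show thesis
    proof (rule that)
      show "?J \<in> bidual sE" by (rule canonical_embedding_in_bidual)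
      show "bidual_norm sE ?J = 1" by (simp add: E.bidual_norm_canonical_embedding x)
      show "norm T \<le> bidual_norm sF (second_adjoint sF T ?J)"
        unfolding second_adjoint_canonical_embedding F.bidual_norm_canonical_embedding
        using True by simp
    qed
  next
    case False
    obtain g where g: "g \<in> dual sF" "norm g \<le> 1" "blinfun_apply g u = of_real (norm u)"
      using F.norming_functional by blast
    let ?h = "adjoint_op T g"
    \<comment> \<open>On the unit vectors \<open>x n\<close> the modulus of \<open>?h\<close> tends
      to \<open>norm T\<close>, so the norm of \<open>?h\<close> is at least that.\<close>
    have "(\<lambda>n. norm (?h (x n))) \<longlonglongrightarrow> norm (g u)"
      unfolding adjoint_op_def by (auto intro!: tendsto_intros lim)
    moreover have "norm (?h (x n)) \<le> norm ?h" for n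
      using norm_blinfun[of ?h "x n"] by (simp add: x)
    ultimately have "norm T \<le> norm ?h"
      using g(3) u by (auto intro: LIMSEQ_le_const2)
    moreover have "?h \<in> dual sE" by (rule adjoint_op_in_dual[OF T g(1)])
    moreover have "?h \<noteq> 0" using False \<open>norm T \<le> norm ?h\<close> by auto
    ultimately obtain \<phi> where \<phi>: "\<phi> \<in> bidual sE" "bidual_norm sE \<phi> = 1"
        "\<phi> ?h = of_real (norm ?h)"
      using E.bidual_norming by blast
    have "norm T \<le> bidual_norm sF (second_adjoint sF T \<phi>)"
      using F.bidual_norm_upper[OF second_adjoint_in_bidual[OF T \<phi>(1)] g(1,2)]
        \<open>norm T \<le> norm ?h\<close> g(1) \<phi>(3) by (simp add: second_adjoint_def)
    then show thesis using \<phi> that by blast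
  qed
  moreover have "bidual_norm sF (second_adjoint sF T \<phi>) \<le> norm T"
    using \<phi> by (intro bidual_norm_second_adjoint_le) auto
  ultimately show ?thesis
    by (auto simp: second_adjoint_attains_norm_def second_adjoint_norm)
qed

text \<open>
  The infimum \<open>p\<close> below is the gauge of the convex hull of a small ball of \<open>F\<close> and the image of
  the unit ball of \<open>E\<close>. A functional dominated by \<open>p\<close> has an adjoint image of norm at most one, so a
  functional attaining \<open>p\<close> at \<open>u\<close> replaces the usual Goldstine and Mazur theorems.
\<close>
lemma approximate_preimage:
  assumes \<phi>: "\<phi> \<in> bidual sE" "bidual_norm sE \<phi> \<le> 1"
    and u: "second_adjoint sF T \<phi> = canonical_embedding sF u" and e: "0 < e"
  shows "\<exists>x. norm x \<le> 1 + e \<and> norm (u - T x) \<le> e"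
proof -
  \<comment> \<open>Since \<open>K * e = 1 + e\<close>, a single bound
    \<open>norm x + K * norm (u - T x) < 1 + e\<close> yields both estimates of the
    conclusion.\<close>
  define K where "K = (1 + e) / e"
  have K: "0 < K" using e by (simp add: K_def)
  define p where "p = (\<lambda>y. INF x. norm x + K * norm (y - T x))"
  have p_le: "p y \<le> norm x + K * norm (y - T x)" for y x
    unfolding p_def using K by (intro cINF_lower bdd_belowI[of _ 0]) auto
  have le_p: "c \<le> p y" if "\<And>x. c \<le> norm x + K * norm (y - T x)" for c y
    unfolding p_def using that by (intro cINF_greatest) auto
  have p_add: "p (y + z) \<le> p y + p z" for y z
  proof -
    have "p (y + z) \<le> (norm b + K * norm (z - T b)) + (norm a + K * norm (y - T a))" for a b
    proof -
      have "norm (y + z - T (a + b)) \<le> norm (y - T a) + norm (z - T b)"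
        using norm_triangle_ineq[of "y - T a" "z - T b"]
        by (simp add: blinfun.add_right algebra_simps)
      then have "K * norm (y + z - T (a + b)) \<le> K * norm (y - T a) + K * norm (z - T b)"
        using K by (simp flip: distrib_left)
      then show ?thesis
        using p_le[of "y + z" "a + b"] norm_triangle_ineq[of a b] by simp
    qed
    then have "p (y + z) - (norm a + K * norm (y - T a)) \<le> p z" for a
      by (intro le_p) (simp only: diff_le_eq)
    then have "p (y + z) - p z \<le> p y" by (intro le_p) (simp add: algebra_simps)
    then show ?thesis by simp
  qed
  have p_scale_le: "p (sF c y) \<le> norm c * p y" if "c \<noteq> 0" for c y
  proof -
    have "p (sF c y) / norm c \<le> norm x + K * norm (y - T x)" for x
    proof -
      have "sF c y - T (sE c x) = sF c (y - T x)"
        by (simp add: T_scale F.scale_right_diff_distrib)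
      then have "norm (sF c y - T (sE c x)) = norm c * norm (y - T x)"
        by (simp only: F.norm_scale)
      then have "p (sF c y) \<le> norm c * (norm x + K * norm (y - T x))"
        using p_le[of "sF c y" "sE c x"]
        by (simp add: E.norm_scale distrib_left mult.left_commute)
      then show ?thesis using that by (simp add: field_simps)
    qed
    then have "p (sF c y) / norm c \<le> p y" by (rule le_p)
    then show ?thesis using that by (simp add: field_simps)
  qed
  have p_scale: "p (sF c y) = norm c * p y" for c y
  proof (cases "c = 0")
    case True
    have "p 0 \<le> 0" using p_le[of 0 0] by simp
    moreover have "0 \<le> p 0" using K by (intro le_p) auto
    ultimately show ?thesis using True by simp
  next
    case False
    \<comment> \<open>The inequality for the inverse scalar turns \<open>p_scale_le\<close> into an
      equality.\<close>
    have "p y \<le> norm (inverse c) * p (sF c y)"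
      using p_scale_le[of "inverse c" "sF c y"] False by simp
    then have "norm c * p y \<le> p (sF c y)" using False by (simp add: norm_divide field_simps)
    then show ?thesis using p_scale_le[OF False, of y] by simp
  qed
  \<comment> \<open>The approximant \<open>x = 0\<close> gives the boundedness that Hahn-Banach asks
    for.\<close>
  have "p y \<le> norm y * K" for y using p_le[of y 0] by (simp add: mult.commute)
  then obtain g where g: "g \<in> dual sF" "\<And>y. norm (blinfun_apply g y) \<le> p y"
      "blinfun_apply g u = of_real (p u)"
    using F.hahn_banach_seminorm[of p K u] p_add p_scale by blast
  \<comment> \<open>Taking \<open>x\<close> itself as approximant of \<open>T x\<close> gives
    \<open>p (T x) \<le> norm x\<close>.\<close>
  have "norm (adjoint_op T g) \<le> 1"
  proof (rule norm_blinfun_bound)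
    show "norm (adjoint_op T g x) \<le> 1 * norm x" for x
      using g(2)[of "T x"] p_le[of "T x" x] by (simp add: adjoint_op_def)
  qed simp
  have "p u \<le> norm (g u)" by (simp add: g(3))
  also have "g u = second_adjoint sF T \<phi> g" using g(1) by (simp add: u canonical_embedding_def)
  also have "norm \<dots> = norm (\<phi> (adjoint_op T g))" using g(1) by (simp add: second_adjoint_def)
  also have "\<dots> \<le> bidual_norm sE \<phi> * norm (adjoint_op T g)"
    by (rule E.bidual_apply_le[OF \<phi>(1) adjoint_op_in_dual[OF T g(1)]])
  also have "\<dots> \<le> 1 * 1"
    using \<phi>(2) \<open>norm (adjoint_op T g) \<le> 1\<close> by (intro mult_mono) auto
  finally have "p u \<le> 1" by simp
  then have "\<not> 1 + e \<le> p u" using e by simp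
  then obtain x where x: "norm x + K * norm (u - T x) < 1 + e"
    using le_p[of "1 + e" u] by (meson not_le)
  have "0 \<le> K * norm (u - T x)" using K by simp
  then have "norm x \<le> 1 + e" using x by simp
  moreover have "K * norm (u - T x) \<le> K * e"
    using x e norm_ge_zero[of x] unfolding K_def by (simp del: norm_ge_zero)
  then have "norm (u - T x) \<le> e" using K by simp
  ultimately show ?thesis by blast
qed

text \<open>Approximate preimages \<open>z n\<close> of \<open>u\<close> must have norms tending to
  1, so normalising them does not change the limit of their images.\<close>

lemma second_adjoint_attains_norm_imp_quasi:
  assumes "reflexive sF" and attains: "second_adjoint_attains_norm sE sF T"
    and x0: "norm (x0 :: 'a) = 1"
  shows "quasi_attains_norm T"
proof (cases "T = 0")
  case True
  then show ?thesis using x0 by (auto simp: quasi_attains_norm_def intro!: exI[of _ "\<lambda>_. x0"])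
next
  case False
  obtain \<phi> where \<phi>: "\<phi> \<in> bidual sE" "bidual_norm sE \<phi> = 1"
      "bidual_norm sF (second_adjoint sF T \<phi>) = norm T"
    using attains by (auto simp: second_adjoint_attains_norm_def second_adjoint_norm)
  obtain u where u: "second_adjoint sF T \<phi> = canonical_embedding sF u"
    using assms(1) second_adjoint_in_bidual[OF T \<phi>(1)] by (auto simp: reflexive_def)
  have nu: "norm u = norm T" using \<phi>(3) by (simp add: u F.bidual_norm_canonical_embedding)
  have "\<exists>x. norm x \<le> 1 + inverse (real (Suc n)) \<and> norm (u - T x) \<le> inverse (real (Suc n))" for n
    using \<phi> by (intro approximate_preimage[OF _ _ u]) auto
  then obtain z where z: "\<And>n. norm (z n) \<le> 1 + inverse (real (Suc n))"
      "\<And>n. norm (u - T (z n)) \<le> inverse (real (Suc n))" by metis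
  have "(\<lambda>n. T (z n) - u) \<longlonglongrightarrow> 0"
    by (rule Lim_null_comparison[OF _ LIMSEQ_inverse_real_of_nat])
      (use z(2) in \<open>auto simp: norm_minus_commute\<close>)
  then have Tz: "(\<lambda>n. T (z n)) \<longlonglongrightarrow> u" by (simp add: LIM_zero_cancel)
  have nz: "(\<lambda>n. norm (z n)) \<longlonglongrightarrow> 1"
  proof (rule tendsto_sandwich)
    \<comment> \<open>The norms of \<open>z n\<close> cannot fall short in the limit, because the
      images tend to a vector of norm \<open>norm T\<close>.\<close>
    show "(\<lambda>n. norm (T (z n)) / norm T) \<longlonglongrightarrow> 1"
      using tendsto_divide[OF tendsto_norm[OF Tz] tendsto_const[of "norm T"]] False by (simp add: nu)
    show "(\<lambda>n. 1 + inverse (real (Suc n))) \<longlonglongrightarrow> 1"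
      by (rule LIMSEQ_inverse_real_of_nat_add)
    show "\<forall>\<^sub>F n in sequentially. norm (T (z n)) / norm T \<le> norm (z n)"
    proof (intro always_eventually allI)
      show "norm (T (z n)) / norm T \<le> norm (z n)" for n
        using norm_blinfun[of T "z n"] False by (simp add: pos_divide_le_eq mult.commute)
    qed
  qed (use z(1) in simp)
  have "(\<lambda>n. inverse (norm (z n)) *\<^sub>R T (z n)) \<longlonglongrightarrow> inverse 1 *\<^sub>R u"
    by (intro tendsto_intros nz Tz) simp
  \<comment> \<open>\<open>x0\<close> is a default for the indices with \<open>z n = 0\<close>, of
    which there are finitely many.\<close>
  moreover define y where "y n = (if z n = 0 then x0 else inverse (norm (z n)) *\<^sub>R z n)" for n
  have "\<forall>\<^sub>F n in sequentially. T (y n) = inverse (norm (z n)) *\<^sub>R T (z n)"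
    using order_tendstoD(1)[OF nz zero_less_one]
    by eventually_elim (auto simp: y_def blinfun.scaleR_right)
  ultimately have "(\<lambda>n. T (y n)) \<longlonglongrightarrow> u"
    by (simp add: tendsto_cong)
  moreover have "norm (y n) = 1" for n by (simp add: y_def x0)
  ultimately show ?thesis using nu by (auto simp: quasi_attains_norm_def)
qed

lemma second_adjoint_attains_norm_imp_attains:
  assumes "reflexive sE" and attains: "second_adjoint_attains_norm sE sF T"
  shows "attains_norm T"
proof -
  obtain \<phi> where \<phi>: "\<phi> \<in> bidual sE" "bidual_norm sE \<phi> = 1"
      "bidual_norm sF (second_adjoint sF T \<phi>) = norm T"
    using attains by (auto simp: second_adjoint_attains_norm_def second_adjoint_norm)
  then obtain x where x: "\<phi> = canonical_embedding sE x"
    using assms(1) by (auto simp: reflexive_def)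
  \<comment> \<open>The embedding is isometric and carries \<open>T\<close> to its second adjoint,
    so \<open>x\<close> is a unit vector where \<open>T\<close> attains its norm.\<close>
  then show ?thesis
    using \<phi>(2,3) by (auto simp: attains_norm_def E.bidual_norm_canonical_embedding
        second_adjoint_canonical_embedding F.bidual_norm_canonical_embedding)
qed

end

section \<open>Comparison of the three maximizing properties of a pair\<close>

lemma attains_norm_imp_quasi:
  assumes "attains_norm T"
  shows "quasi_attains_norm T"
proof -
  obtain x where "norm x = 1" "norm (T x) = norm T" using assms by (auto simp: attains_norm_def)
  then show ?thesis
    unfolding quasi_attains_norm_def by (intro exI[of _ "\<lambda>_. x"] exI[of _ "T x"]) auto
qed

theorem proposition2p16:
  fixes scaleE :: "'k::real_or_complex \<Rightarrow> 'a::banach \<Rightarrow> 'a"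
    and scaleF :: "'k \<Rightarrow> 'b::banach \<Rightarrow> 'b"
  assumes "banach_over scaleE" and "banach_over scaleF"
  shows "(quasi_WMP scaleE scaleF \<longrightarrow> bidual_WMP scaleE scaleF) \<and>
    (reflexive scaleF \<longrightarrow> (quasi_WMP scaleE scaleF \<longleftrightarrow> bidual_WMP scaleE scaleF)) \<and>
    (reflexive scaleE \<longrightarrow>
       (WMP scaleE scaleF \<longleftrightarrow> quasi_WMP scaleE scaleF) \<and>
       (quasi_WMP scaleE scaleF \<longleftrightarrow> bidual_WMP scaleE scaleF))"
proof -
  have op: "operator_over scaleE scaleF T" if "T \<in> operators scaleE scaleF" for T
    using that assms
    by (intro operator_over.intro operator_over_axioms.intro banach_over.normed_over)
  have a: "bidual_WMP scaleE scaleF" if "quasi_WMP scaleE scaleF"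
    using that op operator_over.quasi_attains_norm_imp_second_adjoint
    unfolding quasi_WMP_def bidual_WMP_def by blast
  \<comment> \<open>The unit vector \<open>x0\<close> is a term of the given maximizing
    sequence.\<close>
  have b: "quasi_WMP scaleE scaleF" if "reflexive scaleF" "bidual_WMP scaleE scaleF"
    using that op operator_over.second_adjoint_attains_norm_imp_quasi
    unfolding quasi_WMP_def bidual_WMP_def maximizing_sequence_def by blast
  have c: "WMP scaleE scaleF" if "reflexive scaleE" "bidual_WMP scaleE scaleF"
    using that op operator_over.second_adjoint_attains_norm_imp_attains
    unfolding WMP_def bidual_WMP_def by blast
  have d: "quasi_WMP scaleE scaleF" if "WMP scaleE scaleF"
    using that attains_norm_imp_quasi unfolding quasi_WMP_def WMP_def by blast
  \<comment> \<open>For reflexive E the implications \<open>c\<close>, \<open>d\<close> and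
    \<open>a\<close> close a cycle; for reflexive F, \<open>b\<close> reverses
    \<open>a\<close>.\<close>
  show ?thesis using a b c d by blast
qed

end
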